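(* Let $\epsilon>0$, $\delta>0$ and $k>0$ be constants, and let $C>0$ be a constant. For each $n\ge 1$ let $m=m(n)$ be an integer with $m\geq (2+\delta)n$, and let $A=A^{(n)}$ be an $\epsilon$-balanced random $n\times m$ integer matrix whose entries satisfy $|A_{ij}|\le C\,2^{n^{k}}$ almost surely. Then there is a constant $c>0$ (depending only on $\epsilon,\delta,k,C$) such that \[\mathbb{P}\big(A:\mathbb{Z}^{m}\to\mathbb{Z}^{n}\text{ is surjective}\big)=1-O(e^{-cn})\quad\text{as } n\to\infty.\]
   Context: A random variable $y$ taking values in $\mathbb{Z}$ is called $\epsilon$-balanced if for every prime $p$ and every residue $r\in\mathbb{Z}/p\mathbb{Z}$ we have $\mathbb{P}(y\equiv r \pmod p)\le 1-\epsilon$. (More generally, a random variable in a ring $T$ is $\epsilon$-balanced if for every maximal ideal $\mathfrak p$ of $T$ and every $r\in T/\mathfrak p$, $\mathbb{P}(y\equiv r\pmod{\mathfrak p})\le 1-\epsilon$; over a field this means $\mathbb{P}(y=r)\le 1-\epsilon$ for every $r$.) A random matrix is $\epsilon$-balanced if its entries are independent and each entry is $\epsilon$-balanced. An integer $n\times m$ matrix is viewed as a group homomorphism $\mathbb{Z}^m\to\mathbb{Z}^n$. *)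

theory Defs
  imports "HOL-Probability.Probability"
begin

definition eps_balanced :: "real \<Rightarrow> int pmf \<Rightarrow> bool" where
  "eps_balanced eps \<mu> \<longleftrightarrow>
     (\<forall>p::int. prime p \<longrightarrow> (\<forall>r::int.
        measure_pmf.prob \<mu> {y. y mod p = r mod p} \<le> 1 - eps))"

definition int_mat_surj :: "nat \<Rightarrow> nat \<Rightarrow> (nat \<times> nat \<Rightarrow> int) \<Rightarrow> bool" where
  "int_mat_surj n m A \<longleftrightarrow>
     (\<forall>y :: nat \<Rightarrow> int. \<exists>x :: nat \<Rightarrow> int.
        \<forall>i<n. (\<Sum>j<m. A (i, j) * x j) = y i)"

definition random_matrix :: "nat \<Rightarrow> nat \<Rightarrow> (nat \<times> nat \<Rightarrow> int pmf) \<Rightarrow> (nat \<times> nat \<Rightarrow> int) pmf" where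
  "random_matrix n m \<mu> = Pi_pmf ({..<n} \<times> {..<m}) 0 \<mu>"

end

theory Submission
  imports Defs "Jordan_Normal_Form.Determinant" "HOL-Number_Theory.Cong" "HOL-Real_Asymp.Real_Asymp"
begin

text \<open>
  Let \<open>q = 1 - \<epsilon>\<close> and split off two disjoint blocks of \<open>h = \<lfloor>(1 + \<delta>/2)n\<rfloor>\<close> columns. Modulo any
  prime, however large, a subspace of dimension \<open>r\<close> of \<open>F\<^sub>p\<^sup>h\<close> is determined by \<open>r\<close> coordinates, so it
  contains a fixed random row with probability at most \<open>q\<^bsup>h - r\<^esup>\<close>; summing over the rows, a block
  fails to be surjective modulo \<open>p\<close> with probability at most \<open>n q\<^bsup>h + 1 - n\<^esup>\<close>, uniformly in \<open>p\<close>.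
  If the first block is surjective modulo 2, then its image contains \<open>d \<int>\<^sup>n\<close> for some odd
  determinant \<open>d\<close>, which by the size bound on the entries has only polynomially many prime divisors.
  The second block is independent of \<open>d\<close> and, with high probability, surjective modulo all of them,
  and then the whole matrix is surjective over \<open>\<int>\<close>.
\<close>

section \<open>Linear algebra modulo a prime\<close>

text \<open>The column set \<open>J\<close> is explicit so that two disjoint blocks of one matrix
  can be compared with the whole matrix without renumbering columns.\<close>

definition surj_mod :: "int \<Rightarrow> nat \<Rightarrow> nat set \<Rightarrow> (nat \<times> nat \<Rightarrow> int) \<Rightarrow> bool" where
  "surj_mod p n J A \<longleftrightarrow>
     (\<forall>y. \<exists>x. \<forall>i<n. [(\<Sum>j\<in>J. A (i, j) * x j) = y i] (mod p))"

text \<open>Comparing with the earlier rows only makes row \<open>i\<close> independent of the span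
  once the matrix is random.\<close>

definition row_in_span_mod :: "int \<Rightarrow> nat \<Rightarrow> nat set \<Rightarrow> (nat \<times> nat \<Rightarrow> int) \<Rightarrow> bool" where
  "row_in_span_mod p i J A \<longleftrightarrow>
     (\<exists>w. \<forall>j\<in>J. [A (i, j) = (\<Sum>a<i. w a * A (a, j))] (mod p))"

text \<open>Induction on the rows: if the new row is not a combination of the earlier ones, some
  vector is killed by all earlier rows but not by the new one. Adding a multiple of it corrects the
  last coordinate and leaves the others alone.\<close>

lemma surj_mod_if_rows_independent:
  assumes p: "prime p" and J: "finite J"
    and indep: "\<And>i. i < n \<Longrightarrow> \<not> row_in_span_mod p i J A"
  shows "surj_mod p n J A"
  using indep
proof (induction n)
  case 0
  then show ?case by (simp add: surj_mod_def)
next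
  case (Suc n)
  define L where "L = (\<lambda>i x. \<Sum>j\<in>J. A (i, j) * x j)"
  have ex: "\<exists>x. \<forall>i<n. [L i x = y i] (mod p)" for y
    using Suc unfolding surj_mod_def L_def by auto
  have "\<forall>a. \<exists>x. \<forall>i<n. [L i x = (if i = a then 1 else 0)] (mod p)"
    by (intro allI ex)
  from choice[OF this] obtain X where
    X: "\<forall>a. \<forall>i<n. [L i (X a) = (if i = a then 1 else 0)] (mod p)" ..
  have "\<forall>w. \<exists>j\<in>J. \<not> [A (n, j) = (\<Sum>a<n. w a * A (a, j))] (mod p)"
    using Suc.prems[of n] by (simp add: row_in_span_mod_def)
  \<comment> \<open>Since \<open>X\<close> is dual to the first \<open>n\<close> rows, evaluating a
    combination equal to row \<open>n\<close> at \<open>X a\<close> shows that its coefficients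
    could only be \<open>L n (X a)\<close>. Column \<open>j0\<close> witnesses that they
    fail.\<close>
  then have "\<exists>j\<in>J. \<not> [A (n, j) = (\<Sum>a<n. L n (X a) * A (a, j))] (mod p)" ..
  then obtain j0 where j0: "j0 \<in> J"
    "\<not> [A (n, j0) = (\<Sum>a<n. L n (X a) * A (a, j0))] (mod p)" ..
  \<comment> \<open>The unit vector at \<open>j0\<close>, corrected by the dual vectors so that the
    earlier rows vanish on it.\<close>
  define z where "z = (\<lambda>j. (if j = j0 then 1 else 0) - (\<Sum>a<n. A (a, j0) * X a j))"
  have Lz: "L i z = A (i, j0) - (\<Sum>a<n. L i (X a) * A (a, j0))" for i
  proof -
    have "L i z = (\<Sum>j\<in>J. A (i, j) * (if j = j0 then 1 else 0))
        - (\<Sum>j\<in>J. \<Sum>a<n. A (i, j) * (A (a, j0) * X a j))"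
      unfolding L_def z_def by (simp add: right_diff_distrib sum_subtractf sum_distrib_left)
    also have "(\<Sum>j\<in>J. A (i, j) * (if j = j0 then 1 else 0)) = A (i, j0)"
      using j0 J by (simp add: if_distrib cong: if_cong)
    also have "(\<Sum>j\<in>J. \<Sum>a<n. A (i, j) * (A (a, j0) * X a j))
        = (\<Sum>a<n. L i (X a) * A (a, j0))"
      unfolding L_def by (subst sum.swap) (simp add: sum_distrib_left sum_distrib_right mult_ac)
    finally show ?thesis .
  qed
  have Lz0: "[L i z = 0] (mod p)" if "i < n" for i
  proof -
    have "[L i z = A (i, j0) - (\<Sum>a<n. (if i = a then 1 else 0) * A (a, j0))] (mod p)"
      unfolding Lz by (intro cong_diff cong_sum cong_mult cong_refl X[rule_format] that)
    also have "(\<Sum>a<n. (if i = a then 1 else 0) * A (a, j0)) = A (i, j0)"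
      using that by (simp add: if_distrib if_distribR cong: if_cong)
    finally show ?thesis by simp
  qed
  have "\<not> p dvd L n z"
    using j0(2) unfolding Lz by (simp add: cong_iff_dvd_diff)
  with p have "coprime (L n z) p"
    by (simp add: prime_imp_coprime coprime_commute)
  then obtain s where s: "[L n z * s = 1] (mod p)"
    using cong_solve_coprime_int by blast
  show ?case
    unfolding surj_mod_def
  proof
    fix y
    obtain x where x: "\<And>i. i < n \<Longrightarrow> [L i x = y i] (mod p)" using ex by blast
    define t where "t = s * (y n - L n x)"
    define x' where "x' = (\<lambda>j. x j + t * z j)"
    have Lx': "L i x' = L i x + L i z * t" for i
      unfolding L_def x'_def by (simp add: algebra_simps sum.distrib sum_distrib_left)
    have "[L i x' = y i] (mod p)" if "i < Suc n" for i
    proof (cases "i = n")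
      case True
      have "[L n x + (L n z * s) * (y n - L n x) = L n x + 1 * (y n - L n x)] (mod p)"
        using s by (intro cong_add cong_mult cong_refl)
      then show ?thesis using True by (simp add: Lx' t_def mult_ac)
    next
      case False
      then have i: "i < n" using that by simp
      have "[L i x + L i z * t = y i + 0 * t] (mod p)"
        using x[OF i] Lz0[OF i] by (intro cong_add cong_mult cong_refl)
      then show ?thesis by (simp add: Lx')
    qed
    then show "\<exists>x. \<forall>i<Suc n. [(\<Sum>j\<in>J. A (i, j) * x j) = y i] (mod p)"
      unfolding L_def by blast
  qed
qed

text \<open>A span of \<open>i\<close> vectors has dimension at most \<open>i\<close>, so
  \<open>i\<close> suitable coordinates determine its elements. By linearity it is enough to detect
  zero. In the induction a new row costs at most one new coordinate \<open>j1\<close>, one where a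
  combination vanishing on \<open>J0\<close> is nonzero.\<close>

lemma span_determined_mod:
  fixes R :: "nat \<Rightarrow> nat \<Rightarrow> int"
  assumes p: "prime p"
  shows "\<exists>J0\<subseteq>J. finite J0 \<and> card J0 \<le> i \<and>
    (\<forall>w. (\<forall>j\<in>J0. p dvd (\<Sum>a<i. w a * R a j)) \<longrightarrow> (\<forall>j\<in>J. p dvd (\<Sum>a<i. w a * R a j)))"
proof (induction i)
  case 0
  show ?case by (intro exI[of _ "{}"]) auto
next
  case (Suc i)
  define S where "S = (\<lambda>w j. \<Sum>a<i. w a * R a j)"
  obtain J0 where J0: "J0 \<subseteq> J" "finite J0" "card J0 \<le> i"
    and det: "\<forall>w. (\<forall>j\<in>J0. p dvd S w j) \<longrightarrow> (\<forall>j\<in>J. p dvd S w j)"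
    using Suc unfolding S_def by (elim exE conjE)
  show ?case
  proof (cases "\<forall>w. (\<forall>j\<in>J0. p dvd (\<Sum>a<Suc i. w a * R a j)) \<longrightarrow>
      (\<forall>j\<in>J. p dvd (\<Sum>a<Suc i. w a * R a j))")
    case True
    then show ?thesis using J0 by (intro exI[of _ J0]) auto
  next
    case False
    then obtain w j1 where w: "\<And>j. j \<in> J0 \<Longrightarrow> p dvd S w j + w i * R i j"
      and j1: "j1 \<in> J" "\<not> p dvd S w j1 + w i * R i j1"
      by (auto simp: S_def)
    have "p dvd S v j + v i * R i j"
      if v: "\<And>j. j \<in> insert j1 J0 \<Longrightarrow> p dvd S v j + v i * R i j" and j: "j \<in> J" for v j
    proof -
      \<comment> \<open>This combination of \<open>v\<close> and \<open>w\<close> cancels row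
        \<open>i\<close>, so the induction hypothesis applies to it. Its vanishing at
        \<open>j1\<close> forces \<open>p\<close> to divide \<open>v i\<close>, and then
        \<open>v\<close> itself reduces to the first \<open>i\<close> rows.\<close>
      define u where "u = (\<lambda>a. w i * v a - v i * w a)"
      have Su: "S u j = w i * (S v j + v i * R i j) - v i * (S w j + w i * R i j)" for j
        unfolding S_def u_def by (simp add: algebra_simps sum_subtractf sum_distrib_left)
      have "p dvd S u j'" if "j' \<in> J0" for j'
        unfolding Su using v w that by (intro dvd_diff dvd_mult) auto
      then have "p dvd S u j1" using det[rule_format, of u] j1(1) by simp
      moreover have "p dvd S v j1 + v i * R i j1" using v by simp
      ultimately have "p dvd w i * (S v j1 + v i * R i j1) - S u j1"
        by (intro dvd_diff dvd_mult)
      then have "p dvd v i * (S w j1 + w i * R i j1)" by (simp add: Su)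
      with j1 p have vi: "p dvd v i" by (simp add: prime_dvd_mult_iff)
      then have "p dvd S v j'" if "j' \<in> J0" for j'
        using v[of j'] that by (simp add: dvd_add_left_iff)
      then have "p dvd S v j" using det[rule_format, of v] j by simp
      with vi show ?thesis by simp
    qed
    then have "\<forall>v. (\<forall>j\<in>insert j1 J0. p dvd (\<Sum>a<Suc i. v a * R a j)) \<longrightarrow>
      (\<forall>j\<in>J. p dvd (\<Sum>a<Suc i. v a * R a j))"
      by (auto simp: S_def)
    moreover have "card (insert j1 J0) \<le> Suc i"
      using J0 by (simp add: card_insert_if)
    moreover have "insert j1 J0 \<subseteq> J" "finite (insert j1 J0)"
      using J0 j1(1) by auto
    ultimately show ?thesis by blast
  qed
qed

section \<open>From surjectivity modulo primes to surjectivity over the integers\<close>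

text \<open>Prime factors are stripped from \<open>d\<close> one at a time. If d = q e, surjectivity
  modulo q gives y = A x + q u, hence e y = A (e x) + d u, and d u lies in the image
  already.\<close>

lemma int_mat_surj_if_surj_mod:
  assumes "d > 0"
    and "\<And>y. \<exists>x. \<forall>i<n. (\<Sum>j<m. A (i, j) * x j) = int d * y i"
    and mod: "\<And>p. prime p \<Longrightarrow> p dvd int d \<Longrightarrow> surj_mod p n {..<m} A"
  shows "int_mat_surj n m A"
  using assms
proof (induction d rule: less_induct)
  case (less d)
  show ?case
  proof (cases "d = 1")
    case True
    then show ?thesis using less.prems(2) by (simp add: int_mat_surj_def)
  next
    case False
    then obtain q where q: "prime q" "q dvd d" using prime_factor_nat by blast
    then obtain e where e: "d = q * e" by blast
    have "e < d" "e > 0" using e less.prems(1) prime_gt_1_nat[OF q(1)] by auto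
    moreover have "\<exists>x. \<forall>i<n. (\<Sum>j<m. A (i, j) * x j) = int e * y i" for y
    proof -
      have "surj_mod (int q) n {..<m} A" using less.prems(3)[of "int q"] q by simp
      then obtain x where "\<forall>i<n. [(\<Sum>j<m. A (i, j) * x j) = y i] (mod int q)"
        unfolding surj_mod_def by blast
      then have "\<forall>i<n. \<exists>u. y i - (\<Sum>j<m. A (i, j) * x j) = int q * u"
        by (metis cong_iff_dvd_diff cong_sym dvdE)
      then obtain u where u: "\<And>i. i < n \<Longrightarrow> y i - (\<Sum>j<m. A (i, j) * x j) = int q * u i"
        by metis
      obtain v where v: "\<And>i. i < n \<Longrightarrow> (\<Sum>j<m. A (i, j) * v j) = int d * u i"
        using less.prems(2) by blast
      have "(\<Sum>j<m. A (i, j) * (int e * x j + v j)) = int e * y i" if "i < n" for i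
      proof -
        have "(\<Sum>j<m. A (i, j) * (int e * x j + v j))
            = int e * (\<Sum>j<m. A (i, j) * x j) + (\<Sum>j<m. A (i, j) * v j)"
          by (simp add: algebra_simps sum.distrib sum_distrib_left)
        also have "\<dots> = int e * ((\<Sum>j<m. A (i, j) * x j) + int q * u i)"
          using v[OF that] e by (simp add: algebra_simps)
        also have "(\<Sum>j<m. A (i, j) * x j) + int q * u i = y i"
          using u[OF that] by simp
        finally show ?thesis .
      qed
      then show ?thesis by (intro exI[of _ "\<lambda>j. int e * x j + v j"]) simp
    qed
    moreover have "surj_mod p n {..<m} A" if "prime p" "p dvd int e" for p
      using that less.prems(3) e by simp
    ultimately show ?thesis by (rule less.IH)
  qed
qed

lemma surj_mod_mono:
  assumes "surj_mod p n I A" "I \<subseteq> J" "finite J"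
  shows "surj_mod p n J A"
  unfolding surj_mod_def
proof
  fix y
  obtain x where x: "\<forall>i<n. [(\<Sum>j\<in>I. A (i, j) * x j) = y i] (mod p)"
    using assms(1) unfolding surj_mod_def by blast
  have "(\<Sum>j\<in>J. A (i, j) * (if j \<in> I then x j else 0)) = (\<Sum>j\<in>I. A (i, j) * x j)" for i
    using assms by (intro sum.mono_neutral_cong_right) auto
  with x show "\<exists>x. \<forall>i<n. [(\<Sum>j\<in>J. A (i, j) * x j) = y i] (mod p)"
    by (intro exI[of _ "\<lambda>j. if j \<in> I then x j else 0"]) simp
qed

section \<open>Determinants and their prime divisors\<close>

text \<open>Leibniz expansion together with n! \<le> n^n. This is cruder than Hadamard's inequality,
  but later only the logarithm of the determinant matters.\<close>

lemma abs_det_le: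
  fixes M :: "int mat"
  assumes M: "M \<in> carrier_mat n n"
    and bound: "\<And>i j. i < n \<Longrightarrow> j < n \<Longrightarrow> real_of_int \<bar>M $$ (i, j)\<bar> \<le> b"
  shows "real_of_int \<bar>Determinant.det M\<bar> \<le> (real n * b) ^ n"
proof -
  let ?P = "{p. p permutes {0..<n}}"
  have "real_of_int \<bar>Determinant.det M\<bar>
      = \<bar>\<Sum>p\<in>?P. real_of_int (signof p) * (\<Prod>i=0..<n. real_of_int (M $$ (i, p i)))\<bar>"
    unfolding det_def'[OF M] by simp
  also have "\<dots> \<le> (\<Sum>p\<in>?P. \<bar>real_of_int (signof p) * (\<Prod>i=0..<n. real_of_int (M $$ (i, p i)))\<bar>)"
    by (rule sum_abs)
  also have "\<dots> \<le> (\<Sum>p\<in>?P. b ^ n)"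
  proof (rule sum_mono)
    fix p assume p: "p \<in> ?P"
    have "\<bar>real_of_int (signof p) * (\<Prod>i=0..<n. real_of_int (M $$ (i, p i)))\<bar>
        = (\<Prod>i=0..<n. real_of_int \<bar>M $$ (i, p i)\<bar>)"
      by (simp add: abs_mult abs_prod sign_def)
    also have "\<dots> \<le> (\<Prod>i=0..<n. b)"
      using p bound by (intro prod_mono) (auto dest: permutes_in_image)
    finally show "\<bar>real_of_int (signof p) * (\<Prod>i=0..<n. real_of_int (M $$ (i, p i)))\<bar> \<le> b ^ n"
      by simp
  qed
  also have "\<dots> = fact n * b ^ n"
    by (simp add: card_permutations)
  also have "\<dots> \<le> real n ^ n * b ^ n"
  \<comment> \<open>An actual entry is what forces \<open>b\<close> to be nonnegative, so the empty
    matrix is treated apart.\<close>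
  proof (cases "n = 0")
    case False
    then have "b \<ge> 0" using bound[of 0 0] by linarith
    then show ?thesis using fact_le_power[of n, where ?'a = real] by (intro mult_right_mono) auto
  qed auto
  finally show ?thesis by (simp add: power_mult_distrib)
qed

lemma odd_det_if_cong_one:
  fixes M :: "int mat"
  assumes M: "M \<in> carrier_mat n n"
    and cong: "\<And>i j. i < n \<Longrightarrow> j < n \<Longrightarrow> [M $$ (i, j) = (if i = j then 1 else 0)] (mod 2)"
  shows "odd (Determinant.det M)"
proof -
  have "[Determinant.det M = Determinant.det (1\<^sub>m n :: int mat)] (mod 2)"
    unfolding det_def'[OF M] det_def'[OF one_carrier_mat]
    using cong by (intro cong_sum cong_mult cong_prod cong_refl) (auto dest: permutes_in_image)
  then show ?thesis by (simp add: cong_def odd_iff_mod_2_eq_one)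
qed

text \<open>The adjugate shows that the image contains det(M) times every integer vector, for an
  integral product M of the block with another matrix. Surjectivity modulo 2 allows M to be chosen
  with odd, hence nonzero, determinant, and \<open>d\<close> is its absolute value.\<close>

lemma image_has_small_index:
  assumes surj: "surj_mod 2 n J A" and J: "finite J"
    and bound: "\<And>i j. i < n \<Longrightarrow> j \<in> J \<Longrightarrow> real_of_int \<bar>A (i, j)\<bar> \<le> b"
  obtains d where "d > 0" "real d \<le> (real n * (real (card J) * b)) ^ n"
    "\<And>y. \<exists>x. \<forall>i<n. (\<Sum>j\<in>J. A (i, j) * x j) = int d * y i"
proof -
  \<comment> \<open>A right inverse modulo 2 with entries in \<open>{0, 1}\<close> has an integral product with \<open>A\<close> of odd
    determinant; this product is the matrix \<open>M\<close> below.\<close>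
  have "\<forall>a. \<exists>x. \<forall>i<n. [(\<Sum>j\<in>J. A (i, j) * x j) = (if i = a then 1 else 0)] (mod 2)"
    using surj unfolding surj_mod_def by (intro allI) (erule allE)
  from choice[OF this] obtain X where
    X: "\<forall>a. \<forall>i<n. [(\<Sum>j\<in>J. A (i, j) * X a j) = (if i = a then 1 else 0)] (mod 2)" ..
  define M where "M = mat n n (\<lambda>(i, a). \<Sum>j\<in>J. A (i, j) * (X a j mod 2))"
  have M: "M \<in> carrier_mat n n" unfolding M_def by simp
  have ent: "M $$ (i, a) = (\<Sum>j\<in>J. A (i, j) * (X a j mod 2))" if "i < n" "a < n" for i a
    unfolding M_def using that by simp
  have "[M $$ (i, a) = (if i = a then 1 else 0)] (mod 2)" if "i < n" "a < n" for i a
  proof -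
    have "[M $$ (i, a) = (\<Sum>j\<in>J. A (i, j) * X a j)] (mod 2)"
      unfolding ent[OF that] by (intro cong_sum cong_mult cong_refl) simp
    then show ?thesis using X[rule_format, OF that(1), of a] by (rule cong_trans)
  qed
  then have odd: "odd (Determinant.det M)" using odd_det_if_cong_one[OF M] by blast
  have "real_of_int \<bar>M $$ (i, a)\<bar> \<le> real (card J) * b" if "i < n" "a < n" for i a
  proof -
    have "real_of_int \<bar>M $$ (i, a)\<bar> \<le> real_of_int (\<Sum>j\<in>J. \<bar>A (i, j) * (X a j mod 2)\<bar>)"
      unfolding ent[OF that] of_int_le_iff by (rule sum_abs)
    also have "\<dots> = (\<Sum>j\<in>J. real_of_int \<bar>A (i, j) * (X a j mod 2)\<bar>)" by simp
    also have "\<dots> \<le> (\<Sum>j\<in>J. b)"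
    proof (rule sum_mono)
      fix j assume "j \<in> J"
      have "\<bar>A (i, j) * (X a j mod 2)\<bar> \<le> \<bar>A (i, j)\<bar>"
        by (cases "even (X a j)") (auto simp: odd_iff_mod_2_eq_one)
      then show "real_of_int \<bar>A (i, j) * (X a j mod 2)\<bar> \<le> b"
        using bound[OF that(1) \<open>j \<in> J\<close>] by linarith
    qed
    finally show ?thesis by simp
  qed
  then have small: "real_of_int \<bar>Determinant.det M\<bar> \<le> (real n * (real (card J) * b)) ^ n"
    using abs_det_le[OF M] by blast
  define D where "D = Determinant.det M"
  define N where "N = adj_mat M"
  have N: "N \<in> carrier_mat n n" and MN: "M * N = D \<cdot>\<^sub>m 1\<^sub>m n"
    using adj_mat[OF M] unfolding N_def D_def by auto
  have MN_ent: "(\<Sum>a<n. M $$ (i, a) * N $$ (a, c)) = (if i = c then D else 0)"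
    if "i < n" "c < n" for i c
  proof -
    have "(M * N) $$ (i, c) = (\<Sum>a<n. M $$ (i, a) * N $$ (a, c))"
      using that M N by (simp add: scalar_prod_def atLeast0LessThan)
    then show ?thesis using that by (cases "i = c") (simp_all add: MN)
  qed
  have img: "\<exists>x. \<forall>i<n. (\<Sum>j\<in>J. A (i, j) * x j) = \<bar>D\<bar> * y i" for y
  proof -
    \<comment> \<open>The adjugate applied to the target and then pulled back through the reduced
      right inverse; \<open>sgn D\<close> turns the determinant into its absolute value.\<close>
    define x where "x = (\<lambda>j. \<Sum>a<n. (X a j mod 2) * (\<Sum>c<n. N $$ (a, c) * (sgn D * y c)))"
    have "(\<Sum>j\<in>J. A (i, j) * x j) = \<bar>D\<bar> * y i" if "i < n" for i
    proof -
      have "(\<Sum>j\<in>J. A (i, j) * x j)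
          = (\<Sum>a<n. M $$ (i, a) * (\<Sum>c<n. N $$ (a, c) * (sgn D * y c)))"
      proof -
        have "(\<Sum>j\<in>J. A (i, j) * x j) = (\<Sum>a<n. \<Sum>j\<in>J. A (i, j) * (X a j mod 2)
            * (\<Sum>c<n. N $$ (a, c) * (sgn D * y c)))"
          unfolding x_def by (subst sum.swap) (simp add: sum_distrib_left mult_ac)
        then show ?thesis using that by (simp add: ent sum_distrib_right)
      qed
      also have "\<dots> = (\<Sum>c<n. \<Sum>a<n. M $$ (i, a) * N $$ (a, c) * (sgn D * y c))"
        by (subst sum.swap) (simp add: sum_distrib_left mult_ac)
      also have "\<dots> = (\<Sum>c<n. (if i = c then D else 0) * (sgn D * y c))"
        using that by (simp add: MN_ent flip: sum_distrib_right)
      also have "\<dots> = D * (sgn D * y i)"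
        using that by (simp add: if_distrib if_distribR cong: if_cong)
      also have "\<dots> = \<bar>D\<bar> * y i" by (simp add: abs_sgn mult_ac)
      finally show ?thesis .
    qed
    then show ?thesis by blast
  qed
  show thesis
  proof (rule that)
    show "nat \<bar>D\<bar> > 0" using odd unfolding D_def by auto
    show "real (nat \<bar>D\<bar>) \<le> (real n * (real (card J) * b)) ^ n"
      using small unfolding D_def by simp
    show "\<exists>x. \<forall>i<n. (\<Sum>j\<in>J. A (i, j) * x j) = int (nat \<bar>D\<bar>) * y i" for y
      using img by simp
  qed
qed

text \<open>The product of the distinct prime divisors divides \<open>d\<close>, and each factor is
  at least 2.\<close>

lemma card_prime_divisors_le:
  assumes "d > 0" "real d \<le> 2 powr l"
  shows "finite {p :: int. prime p \<and> p dvd int d}"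
    and "real (card {p :: int. prime p \<and> p dvd int d}) \<le> l"
proof -
  have eq: "{p :: int. prime p \<and> p dvd int d} = prime_factors (int d)"
    using assms by (auto simp: prime_factors_dvd)
  then show "finite {p :: int. prime p \<and> p dvd int d}" by simp
  have "(2::int) ^ card (prime_factors (int d)) = (\<Prod>p\<in>prime_factors (int d). 2)" by simp
  also have "\<dots> \<le> (\<Prod>p\<in>prime_factors (int d). p)"
    by (intro prod_mono) (auto intro: prime_ge_2_int)
  also have "\<dots> \<le> int d"
  proof (rule zdvd_imp_le)
    have "(\<Prod>p\<in>prime_factors (int d). p)
        dvd (\<Prod>p\<in>prime_factors (int d). p ^ multiplicity p (int d))"
      by (intro prod_dvd_prod dvd_power) (auto simp: prime_factors_multiplicity)
    also have "\<dots> = int d" using assms by (subst prod_prime_factors) auto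
    finally show "(\<Prod>p\<in>prime_factors (int d). p) dvd int d" .
  qed (use assms in simp)
  finally have "(2::int) ^ card (prime_factors (int d)) \<le> int d" .
  then have "2 powr real (card (prime_factors (int d))) \<le> real d"
    by (metis of_int_le_iff of_int_of_nat_eq of_int_power of_int_numeral powr_realpow zero_less_numeral)
  with assms have "2 powr real (card (prime_factors (int d))) \<le> 2 powr l" by linarith
  then show "real (card {p :: int. prime p \<and> p dvd int d}) \<le> l" unfolding eq by simp
qed

section \<open>Probability estimates\<close>

text \<open>By independence the coordinates outside \<open>B\<close> can be sampled first, and the
  total probability is an average of conditional ones. Restricting \<open>f\<close> to the support
  lets almost sure bounds on the entries be used for it.\<close>

lemma prob_Pi_pmf_le_if_conditional_le:
  assumes S: "finite S" and B: "B \<subseteq> S" and b: "0 \<le> b"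
    and cond: "\<And>f. f \<in> set_pmf (Pi_pmf (S - B) dflt \<mu>) \<Longrightarrow>
      measure_pmf.prob (Pi_pmf B dflt \<mu>) {g. P (\<lambda>x. if x \<in> B then g x else f x)} \<le> b"
  shows "measure_pmf.prob (Pi_pmf S dflt \<mu>) {A. P A} \<le> b"
proof -
  define M where "M = (\<lambda>f. map_pmf (\<lambda>g x. if x \<in> B then g x else f x) (Pi_pmf B dflt \<mu>))"
  have fin: "finite B" "finite (S - B)" using S B finite_subset by auto
  have "Pi_pmf S dflt \<mu> = Pi_pmf (B \<union> (S - B)) dflt \<mu>" using B by (simp add: Un_absorb1)
  also have "\<dots> = bind_pmf (Pi_pmf (S - B) dflt \<mu>) M"
    using fin unfolding M_def
    by (subst Pi_pmf_union)
       (auto simp: pair_pmf_def map_bind_pmf map_pmf_def bind_assoc_pmf bind_return_pmf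
             intro: bind_commute_pmf)
  finally have eq: "Pi_pmf S dflt \<mu> = bind_pmf (Pi_pmf (S - B) dflt \<mu>) M" .
  have "emeasure (M f) {A. P A} \<le> ennreal b" if "f \<in> set_pmf (Pi_pmf (S - B) dflt \<mu>)" for f
    using cond[OF that] b
    by (simp add: M_def vimage_def measure_pmf.emeasure_eq_measure)
  then have "emeasure (Pi_pmf S dflt \<mu>) {A. P A}
      \<le> (\<integral>\<^sup>+ f. ennreal b \<partial>Pi_pmf (S - B) dflt \<mu>)"
    unfolding eq emeasure_bind_pmf
    by (intro nn_integral_mono_AE) (auto simp: AE_measure_pmf_iff)
  also have "\<dots> = ennreal b" by (simp add: measure_pmf.emeasure_space_1)
  finally show ?thesis using b by (simp add: measure_pmf.emeasure_eq_measure)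
qed

text \<open>Conditioning happens twice: on everything outside row \<open>i\<close>, which fixes the
  span, and then on the entries of row \<open>i\<close> at the at most \<open>i\<close> determining
  coordinates. Each remaining entry then has at most one admissible residue.\<close>

lemma prob_row_in_span_mod_le:
  assumes S: "finite S" "{i} \<times> J \<subseteq> S" and p: "prime p" and q: "0 \<le> q" "q \<le> 1"
    and bal: "\<And>j r. j \<in> J \<Longrightarrow> measure_pmf.prob (\<mu> (i, j)) {y. [y = r] (mod p)} \<le> q"
  shows "measure_pmf.prob (Pi_pmf S 0 \<mu>) {A. row_in_span_mod p i J A} \<le> q ^ (card J - i)"
proof (rule prob_Pi_pmf_le_if_conditional_le[OF S])
  have J: "finite J" using finite_subset[OF S(2,1)] by (auto dest: finite_cartesian_productD2)
  fix f
  obtain J0 where J0: "J0 \<subseteq> J" "finite J0" "card J0 \<le> i" and det: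
    "\<forall>w. (\<forall>j\<in>J0. p dvd (\<Sum>a<i. w a * f (a, j))) \<longrightarrow> (\<forall>j\<in>J. p dvd (\<Sum>a<i. w a * f (a, j)))"
    using span_determined_mod[OF p, of J i "\<lambda>a j. f (a, j)"] by (elim exE conjE)
  define B where "B = {i} \<times> (J - J0)"
  have B: "finite ({i} \<times> J)" "B \<subseteq> {i} \<times> J" using J unfolding B_def by auto
  show "measure_pmf.prob (Pi_pmf ({i} \<times> J) 0 \<mu>)
      {g. row_in_span_mod p i J (\<lambda>x. if x \<in> {i} \<times> J then g x else f x)} \<le> q ^ (card J - i)"
  proof (rule prob_Pi_pmf_le_if_conditional_le[OF B])
    fix g0
    define E where "E = {g. row_in_span_mod p i J
      (\<lambda>x. if x \<in> {i} \<times> J then if x \<in> B then g x else g0 x else f x)}"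
    have EI: "g \<in> E \<longleftrightarrow> (\<exists>w. \<forall>j\<in>J. [(if j \<in> J0 then g0 (i, j) else g (i, j))
        = (\<Sum>a<i. w a * f (a, j))] (mod p))" for g
      unfolding E_def row_in_span_mod_def B_def mem_Collect_eq
      by (intro ex_cong1 ball_cong refl arg_cong2[of _ _ _ _ "\<lambda>s t. [s = t] (mod p)"] sum.cong) auto
    have "measure_pmf.prob (Pi_pmf B 0 \<mu>) E \<le> q ^ (card J - i)"
    proof (cases "E = {}")
      case True
      then show ?thesis using q by simp
    next
      case False
      then obtain g1 w1 where w1: "\<forall>j\<in>J. [(if j \<in> J0 then g0 (i, j) else g1 (i, j))
        = (\<Sum>a<i. w1 a * f (a, j))] (mod p)"
        using EI by auto
      \<comment> \<open>Two admissible combinations agree with \<open>g0\<close> on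
        \<open>J0\<close>, hence with each other on all of \<open>J\<close>. So a single member
        \<open>g1\<close> of the event prescribes the residues of all others.\<close>
      have "E \<subseteq> Pi B (\<lambda>x. {y. [y = g1 x] (mod p)})"
      proof
        fix g assume "g \<in> E"
        then obtain w where w: "\<forall>j\<in>J. [(if j \<in> J0 then g0 (i, j) else g (i, j))
          = (\<Sum>a<i. w a * f (a, j))] (mod p)"
          using EI by auto
        define v where "v = (\<lambda>a. w a - w1 a)"
        have v: "(\<Sum>a<i. v a * f (a, j)) = (\<Sum>a<i. w a * f (a, j)) - (\<Sum>a<i. w1 a * f (a, j))" for j
          unfolding v_def by (simp add: left_diff_distrib sum_subtractf)
        have "p dvd (\<Sum>a<i. v a * f (a, j))" if "j \<in> J0" for j
        proof -
          have "[(\<Sum>a<i. w a * f (a, j)) = (\<Sum>a<i. w1 a * f (a, j))] (mod p)"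
            using w[rule_format, of j] w1[rule_format, of j] that J0(1)
            by (auto intro: cong_trans cong_sym)
          then show ?thesis unfolding v by (simp add: cong_iff_dvd_diff)
        qed
        then have *: "[(\<Sum>a<i. w a * f (a, j)) = (\<Sum>a<i. w1 a * f (a, j))] (mod p)" if "j \<in> J" for j
          using det[rule_format, of v j] that by (simp add: cong_iff_dvd_diff v)
        have "[g (i, j) = g1 (i, j)] (mod p)" if j: "j \<in> J" "j \<notin> J0" for j
        proof -
          have "[g (i, j) = (\<Sum>a<i. w a * f (a, j))] (mod p)"
            using w[rule_format, of j] j by simp
          also note *[OF j(1)]
          also have "[(\<Sum>a<i. w1 a * f (a, j)) = g1 (i, j)] (mod p)"
            using w1[rule_format, of j] j by (simp add: cong_sym)
          finally show ?thesis .
        qed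
        then show "g \<in> Pi B (\<lambda>x. {y. [y = g1 x] (mod p)})" unfolding B_def by auto
      qed
      then have "measure_pmf.prob (Pi_pmf B 0 \<mu>) E
          \<le> measure_pmf.prob (Pi_pmf B 0 \<mu>) (Pi B (\<lambda>x. {y. [y = g1 x] (mod p)}))"
        by (intro measure_pmf.finite_measure_mono) auto
      also have "\<dots> = (\<Prod>x\<in>B. measure_pmf.prob (\<mu> x) {y. [y = g1 x] (mod p)})"
        using B finite_subset by (intro measure_Pi_pmf_Pi) blast
      also have "\<dots> \<le> (\<Prod>x\<in>B. q)"
        using bal by (intro prod_mono) (auto simp: B_def)
      also have "\<dots> = q ^ (card J - card J0)"
        using J0 J unfolding B_def by (simp add: card_Diff_subset card_cartesian_product)
      also have "\<dots> \<le> q ^ (card J - i)"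
        using q J0 by (intro power_decreasing) auto
      finally show ?thesis .
    qed
    then show "measure_pmf.prob (Pi_pmf B 0 \<mu>) {g. row_in_span_mod p i J
        (\<lambda>x. if x \<in> {i} \<times> J then if x \<in> B then g x else g0 x else f x)} \<le> q ^ (card J - i)"
      unfolding E_def .
  qed (use q in simp)
qed (use q in simp)

text \<open>Union bound over the rows. The last row, \<open>i = n - 1\<close>, is the worst, which
  explains the \<open>+ 1\<close> in the exponent. The bound does not depend on
  \<open>p\<close>.\<close>

lemma prob_not_surj_mod_le:
  assumes S: "finite S" "{..<n} \<times> J \<subseteq> S" and J: "finite J"
    and p: "prime p" and q: "0 \<le> q" "q \<le> 1"
    and bal: "\<And>i j r. i < n \<Longrightarrow> j \<in> J \<Longrightarrow>
      measure_pmf.prob (\<mu> (i, j)) {y. [y = r] (mod p)} \<le> q"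
  shows "measure_pmf.prob (Pi_pmf S 0 \<mu>) {A. \<not> surj_mod p n J A} \<le> real n * q ^ (card J + 1 - n)"
proof -
  let ?pr = "measure_pmf.prob (Pi_pmf S 0 \<mu>)"
  have "?pr {A. \<not> surj_mod p n J A} \<le> ?pr (\<Union>i\<in>{..<n}. {A. row_in_span_mod p i J A})"
    using surj_mod_if_rows_independent[OF p J] by (intro measure_pmf.finite_measure_mono) auto
  also have "\<dots> \<le> (\<Sum>i<n. ?pr {A. row_in_span_mod p i J A})"
    by (intro measure_pmf.finite_measure_subadditive_finite) auto
  also have "\<dots> \<le> (\<Sum>i<n. q ^ (card J + 1 - n))"
  proof (rule sum_mono)
    fix i assume i: "i \<in> {..<n}"
    then have "{i} \<times> J \<subseteq> S" using S by auto
    with S(1) have "?pr {A. row_in_span_mod p i J A} \<le> q ^ (card J - i)"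
      using i bal by (intro prob_row_in_span_mod_le p q) auto
    also have "\<dots> \<le> q ^ (card J + 1 - n)" using q i by (intro power_decreasing) auto
    finally show "?pr {A. row_in_span_mod p i J A} \<le> q ^ (card J + 1 - n)" .
  qed
  finally show ?thesis by simp
qed

lemma surj_mod_cong:
  assumes "\<And>i j. i < n \<Longrightarrow> j \<in> J \<Longrightarrow> A (i, j) = B (i, j)"
  shows "surj_mod p n J A \<longleftrightarrow> surj_mod p n J B"
proof -
  have "(\<Sum>j\<in>J. A (i, j) * x j) = (\<Sum>j\<in>J. B (i, j) * x j)" if "i < n" for i x
    using assms that by (intro sum.cong) auto
  then show ?thesis unfolding surj_mod_def by simp
qed

text \<open>The factor \<open>1 + l\<close> counts uses of the bound modulo a prime: once for the
  first block modulo 2, and once for the second block at each of at most \<open>l\<close> prime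
  divisors of \<open>d\<close>.\<close>

lemma prob_not_int_mat_surj_le:
  assumes m: "2 * h \<le> m" and q: "0 \<le> q" "q \<le> 1" and l: "0 \<le> l"
    and bal: "\<And>i j p r. i < n \<Longrightarrow> j < m \<Longrightarrow> prime p \<Longrightarrow>
      measure_pmf.prob (\<mu> (i, j)) {y. [y = r] (mod p)} \<le> q"
    and bound: "\<And>i j a. i < n \<Longrightarrow> j < m \<Longrightarrow> a \<in> set_pmf (\<mu> (i, j)) \<Longrightarrow> real_of_int \<bar>a\<bar> \<le> b"
    and bl: "(real n * (real h * b)) ^ n \<le> 2 powr l"
  shows "1 - measure_pmf.prob (random_matrix n m \<mu>) {A. int_mat_surj n m A}
      \<le> (1 + l) * (real n * q ^ (h + 1 - n))"
proof -
  define S where "S = {..<n} \<times> {..<m}"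
  \<comment> \<open>Conditioning on the complement of \<open>B\<close> fixes exactly the first
    \<open>h\<close> columns, so \<open>d\<close> below is constant while \<open>g\<close> remains
    random.\<close>
  define B where "B = {..<n} \<times> {h..<m}"
  let ?pr = "measure_pmf.prob (Pi_pmf S 0 \<mu>)"
  let ?e = "real n * q ^ (h + 1 - n)"
  have S: "finite S" "B \<subseteq> S" and fB: "finite B" unfolding S_def B_def by auto
  have e: "0 \<le> ?e" using q by simp
  have "{..<n} \<times> {..<h} \<subseteq> S" using m unfolding S_def by auto
  then have 1: "?pr {A. \<not> surj_mod 2 n {..<h} A} \<le> ?e"
    using prob_not_surj_mod_le[OF S(1), of n "{..<h}" 2 q \<mu>] m q bal by simp
  have 2: "?pr {A. surj_mod 2 n {..<h} A \<and> \<not> int_mat_surj n m A} \<le> l * ?e"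
  proof (rule prob_Pi_pmf_le_if_conditional_le[OF S])
    fix f assume f: "f \<in> set_pmf (Pi_pmf (S - B) 0 \<mu>)"
    define G where "G = (\<lambda>g x. if x \<in> B then g x else f x)"
    have G1: "G g (i, j) = f (i, j)" if "j < h" for g i j
      using that unfolding G_def B_def by simp
    have G2: "G g (i, j) = g (i, j)" if "i < n" "h \<le> j" "j < m" for g i j
      using that unfolding G_def B_def by simp
    have sf: "surj_mod 2 n {..<h} (G g) \<longleftrightarrow> surj_mod 2 n {..<h} f" for g
      by (rule surj_mod_cong) (simp add: G1)
    have fb: "real_of_int \<bar>f (i, j)\<bar> \<le> b" if "i < n" "j \<in> {..<h}" for i j
    proof -
      have "(i, j) \<in> S - B" using that m unfolding S_def B_def by auto
      then have "f (i, j) \<in> set_pmf (\<mu> (i, j))"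
        using f S(1) by (auto simp: set_Pi_pmf PiE_dflt_def)
      moreover have "j < m" using that m by simp
      ultimately show ?thesis using bound that(1) by blast
    qed
    have "measure_pmf.prob (Pi_pmf B 0 \<mu>)
        {g. surj_mod 2 n {..<h} (G g) \<and> \<not> int_mat_surj n m (G g)} \<le> l * ?e"
    proof (cases "surj_mod 2 n {..<h} f")
      case False
      then show ?thesis using sf e l by simp
    next
      case True
      from image_has_small_index[OF True finite_lessThan fb]
      obtain d where d: "d > 0" "real d \<le> (real n * (real (card {..<h}) * b)) ^ n"
        and dimg: "\<And>y. \<exists>x. \<forall>i<n. (\<Sum>j<h. f (i, j) * x j) = int d * y i"
        by blast
      define Q where "Q = {p :: int. prime p \<and> p dvd int d}"
      have "real d \<le> 2 powr l" using d(2) bl by simp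
      from card_prime_divisors_le[OF d(1) this]
      have Q: "finite Q" "real (card Q) \<le> l" unfolding Q_def .
      \<comment> \<open>The first block supplies all multiples of \<open>d\<close>. If the second
        block were surjective modulo every prime in \<open>Q\<close>, the whole matrix would be
        surjective over the integers.\<close>
      have "\<exists>p\<in>Q. \<not> surj_mod p n {h..<2 * h} g" if "\<not> int_mat_surj n m (G g)" for g
      proof (rule ccontr)
        assume *: "\<not> (\<exists>p\<in>Q. \<not> surj_mod p n {h..<2 * h} g)"
        have "int_mat_surj n m (G g)"
        proof (rule int_mat_surj_if_surj_mod[OF d(1)])
          fix y
          obtain x where x: "\<forall>i<n. (\<Sum>j<h. f (i, j) * x j) = int d * y i" using dimg by blast
          have "(\<Sum>j<m. G g (i, j) * (if j < h then x j else 0)) = (\<Sum>j<h. f (i, j) * x j)" for i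
            using m by (intro sum.mono_neutral_cong_right) (auto simp: G1)
          with x show "\<exists>x. \<forall>i<n. (\<Sum>j<m. G g (i, j) * x j) = int d * y i"
            by (intro exI[of _ "\<lambda>j. if j < h then x j else 0"]) simp
        next
          fix p :: int assume "prime p" "p dvd int d"
          then have "surj_mod p n {h..<2 * h} g" using * unfolding Q_def by blast
          also have "surj_mod p n {h..<2 * h} g \<longleftrightarrow> surj_mod p n {h..<2 * h} (G g)"
            using m by (intro surj_mod_cong) (simp add: G2)
          finally show "surj_mod p n {..<m} (G g)"
            by (rule surj_mod_mono) (use m in auto)
        qed
        with that show False by blast
      qed
      then have "measure_pmf.prob (Pi_pmf B 0 \<mu>)
          {g. surj_mod 2 n {..<h} (G g) \<and> \<not> int_mat_surj n m (G g)}
        \<le> measure_pmf.prob (Pi_pmf B 0 \<mu>) (\<Union>p\<in>Q. {g. \<not> surj_mod p n {h..<2 * h} g})"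
        by (intro measure_pmf.finite_measure_mono) auto
      also have "\<dots> \<le> (\<Sum>p\<in>Q. measure_pmf.prob (Pi_pmf B 0 \<mu>) {g. \<not> surj_mod p n {h..<2 * h} g})"
        using Q by (intro measure_pmf.finite_measure_subadditive_finite) auto
      also have "\<dots> \<le> (\<Sum>p\<in>Q. ?e)"
      proof (rule sum_mono)
        fix p assume "p \<in> Q"
        then have "prime p" unfolding Q_def by simp
        moreover have "{..<n} \<times> {h..<2 * h} \<subseteq> B" using m unfolding B_def by auto
        ultimately show "measure_pmf.prob (Pi_pmf B 0 \<mu>) {g. \<not> surj_mod p n {h..<2 * h} g} \<le> ?e"
          using prob_not_surj_mod_le[OF fB, of n "{h..<2 * h}" p q \<mu>] m q bal by simp
      qed
      also have "\<dots> \<le> l * ?e" using Q(2) e by (simp only: sum_constant mult_right_mono)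
      finally show ?thesis .
    qed
    then show "measure_pmf.prob (Pi_pmf B 0 \<mu>)
        {g. surj_mod 2 n {..<h} (\<lambda>x. if x \<in> B then g x else f x) \<and>
            \<not> int_mat_surj n m (\<lambda>x. if x \<in> B then g x else f x)} \<le> l * ?e"
      unfolding G_def .
  qed (use l e in simp)
  have "1 - ?pr {A. int_mat_surj n m A} = ?pr {A. \<not> int_mat_surj n m A}"
    using measure_pmf.prob_compl[of "{A. int_mat_surj n m A}" "Pi_pmf S 0 \<mu>"]
    by (simp add: Collect_neg_eq Compl_eq_Diff_UNIV)
  also have "\<dots> \<le> ?pr ({A. \<not> surj_mod 2 n {..<h} A}
      \<union> {A. surj_mod 2 n {..<h} A \<and> \<not> int_mat_surj n m A})"
    by (intro measure_pmf.finite_measure_mono) auto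
  also have "\<dots> \<le> ?pr {A. \<not> surj_mod 2 n {..<h} A}
      + ?pr {A. surj_mod 2 n {..<h} A \<and> \<not> int_mat_surj n m A}"
    by (intro measure_Un_le) auto
  also have "\<dots> \<le> ?e + l * ?e" using 1 2 by (rule add_mono)
  finally show ?thesis unfolding random_matrix_def S_def by (simp add: algebra_simps)
qed

section \<open>Asymptotics and choice of constants\<close>

text \<open>Serves to absorb the number of union bounds and the factor \<open>n\<close> into one of
  two available factors \<open>exp (- c * n)\<close>.\<close>

lemma eventually_poly_powr_exp_le:
  fixes c k D :: real
  assumes "c > 0" "k > 0" "D > 0"
  shows "\<forall>\<^sub>F n::nat in sequentially.
    (1 + real n * (D * real n ^ 2 + real n powr k)) * real n * exp (- c * real n) \<le> 1"
proof -
  have "(\<lambda>n::nat. real n * exp (- c * real n)) \<longlonglongrightarrow> 0"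
    using assms by real_asymp
  moreover have "(\<lambda>n::nat. D * real n ^ 4 * exp (- c * real n)) \<longlonglongrightarrow> 0"
    using assms by real_asymp
  moreover have "(\<lambda>n::nat. real n ^ 2 * real n powr k * exp (- c * real n)) \<longlonglongrightarrow> 0"
    using assms by real_asymp
  ultimately have "(\<lambda>n::nat. real n * exp (- c * real n) + D * real n ^ 4 * exp (- c * real n)
      + real n ^ 2 * real n powr k * exp (- c * real n)) \<longlonglongrightarrow> 0 + 0 + 0"
    by (intro tendsto_add)
  also have "(\<lambda>n::nat. real n * exp (- c * real n) + D * real n ^ 4 * exp (- c * real n)
      + real n ^ 2 * real n powr k * exp (- c * real n)) =
    (\<lambda>n::nat. (1 + real n * (D * real n ^ 2 + real n powr k)) * real n * exp (- c * real n))"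
    by (auto simp: fun_eq_iff algebra_simps power2_eq_square power4_eq_xxxx)
  finally show ?thesis
    by (auto dest!: order_tendstoD(2)[of _ _ _ 1] elim!: eventually_mono)
qed

theorem theorem1:
  fixes eps \<delta> k C :: real
  assumes "eps > 0" "\<delta> > 0" "k > 0" "C > 0"
  shows "\<exists>c > 0. \<forall>(m :: nat \<Rightarrow> nat) (\<mu> :: nat \<Rightarrow> nat \<times> nat \<Rightarrow> int pmf).
      (\<forall>n\<ge>1. real (m n) \<ge> (2 + \<delta>) * real n) \<longrightarrow>
      (\<forall>n\<ge>1. \<forall>i<n. \<forall>j<m n. eps_balanced eps (\<mu> n (i, j))) \<longrightarrow>
      (\<forall>n\<ge>1. \<forall>i<n. \<forall>j<m n. \<forall>a\<in>set_pmf (\<mu> n (i, j)).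
          real_of_int \<bar>a\<bar> \<le> C * 2 powr (real n powr k)) \<longrightarrow>
      (\<exists>K N. \<forall>n\<ge>N. 1 - measure_pmf.prob (random_matrix n (m n) (\<mu> n))
                               {A. int_mat_surj n (m n) A}
                          \<le> K * exp (- c * real n))"
proof -
  \<comment> \<open>The hypotheses force \<open>eps \<le> 1 / 2\<close>, but only once \<open>m\<close> and \<open>\<mu>\<close> are given; the minimum keeps
    \<open>q\<close> positive and \<open>ln q\<close> meaningful before that.\<close>
  define q where "q = 1 - min eps (1 / 2)"
  have q: "0 < q" "q < 1" "1 - eps \<le> q" using assms unfolding q_def by auto
  \<comment> \<open>The quarter makes q^(\<delta> n / 2) equal to exp(-2 c n): one factor exp(-c n)
    pays for the polynomial losses, the other is the final bound.\<close>
  define c where "c = - \<delta> * ln q / 4"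
  have "ln q < 0" using q by simp
  then have c: "c > 0" using assms unfolding c_def by (simp add: mult_pos_neg)
  \<comment> \<open>Chosen so that the polynomial factor (1 + \<delta>/2) C n^2 of the determinant
    bound equals D n^2 ln 2, which is at most 2^(D n^2) because x \<le> e^x.\<close>
  define D where "D = (1 + \<delta> / 2) * C / ln 2"
  have D: "D > 0" using assms unfolding D_def by simp
  obtain N where N: "\<And>n. n \<ge> N \<Longrightarrow>
      (1 + real n * (D * real n ^ 2 + real n powr k)) * real n * exp (- c * real n) \<le> 1"
    using eventually_poly_powr_exp_le[OF c assms(3) D] unfolding eventually_sequentially by blast
  \<comment> \<open>\<open>N\<close> is fixed before \<open>m\<close> and \<open>\<mu>\<close>, so
    the estimate is uniform in both and the constant in front is 1.\<close>
  have main: "1 - measure_pmf.prob (random_matrix n m \<mu>) {A. int_mat_surj n m A}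
      \<le> 1 * exp (- c * real n)"
    if n: "n \<ge> 1" "n \<ge> N" and m: "real m \<ge> (2 + \<delta>) * real n"
      and bal: "\<And>i j. i < n \<Longrightarrow> j < m \<Longrightarrow> eps_balanced eps (\<mu> (i, j))"
      and bound: "\<And>i j a. i < n \<Longrightarrow> j < m \<Longrightarrow> a \<in> set_pmf (\<mu> (i, j)) \<Longrightarrow>
        real_of_int \<bar>a\<bar> \<le> C * 2 powr (real n powr k)"
    for n m \<mu>
  proof -
    \<comment> \<open>Two blocks of this width fit into \<open>m\<close> columns, and each has about
      \<delta> n / 2 columns to spare over \<open>n\<close>. The loss from rounding down is made up
      by the \<open>+ 1\<close> in the exponent \<open>h + 1 - n\<close>.\<close>
    define h where "h = nat \<lfloor>(1 + \<delta> / 2) * real n\<rfloor>"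
    have hn: "0 \<le> (1 + \<delta> / 2) * real n" using assms by simp
    have h: "real h \<le> (1 + \<delta> / 2) * real n" "(1 + \<delta> / 2) * real n < real h + 1"
      using hn unfolding h_def by linarith+
    have hm: "2 * h \<le> m"
    proof -
      have "real (2 * h) \<le> (2 + \<delta>) * real n" using h(1) by (simp add: algebra_simps)
      with m show ?thesis by linarith
    qed
    have nh: "n \<le> h"
    proof -
      have "real n \<le> (1 + \<delta> / 2) * real n" using assms by (simp add: algebra_simps)
      with h(2) show ?thesis by linarith
    qed
    \<comment> \<open>The base of the determinant bound is at most \<open>2 powr t\<close>, so its
      \<open>n\<close>-th power gives \<open>l = n * t\<close>.\<close>
    define t where "t = D * real n ^ 2 + real n powr k"
    have t: "t \<ge> 0" using D unfolding t_def by simp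
    define b where "b = C * 2 powr (real n powr k)"
    have b: "b > 0" using assms unfolding b_def by simp
    have bl: "(real n * (real h * b)) ^ n \<le> 2 powr (real n * t)"
    proof -
      have "real n * (real h * b) \<le> real n * ((1 + \<delta> / 2) * real n * b)"
        using h(1) b by (intro mult_left_mono mult_right_mono) auto
      also have "\<dots> = (D * real n ^ 2 * ln 2) * 2 powr (real n powr k)"
        unfolding b_def D_def by (simp add: power2_eq_square)
      also have "\<dots> \<le> 2 powr (D * real n ^ 2) * 2 powr (real n powr k)"
      proof (rule mult_right_mono)
        have "D * real n ^ 2 * ln 2 \<le> exp (D * real n ^ 2 * ln 2)"
          using exp_ge_add_one_self[of "D * real n ^ 2 * ln 2"] by linarith
        then show "D * real n ^ 2 * ln 2 \<le> 2 powr (D * real n ^ 2)" by (simp add: powr_def)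
      qed simp
      also have "\<dots> = 2 powr t" unfolding t_def by (simp add: powr_add)
      finally have "(real n * (real h * b)) ^ n \<le> (2 powr t) ^ n"
        using b by (intro power_mono) auto
      also have "\<dots> = 2 powr (real n * t)" by (simp add: powr_power mult.commute)
      finally show ?thesis .
    qed
    have "1 - measure_pmf.prob (random_matrix n m \<mu>) {A. int_mat_surj n m A}
        \<le> (1 + real n * t) * (real n * q ^ (h + 1 - n))"
    proof (rule prob_not_int_mat_surj_le[OF hm _ _ _ _ _ bl])
      fix i j :: nat and p r :: int assume "i < n" "j < m" "prime p"
      with bal have "measure_pmf.prob (\<mu> (i, j)) {y. y mod p = r mod p} \<le> 1 - eps"
        unfolding eps_balanced_def by blast
      with q show "measure_pmf.prob (\<mu> (i, j)) {y. [y = r] (mod p)} \<le> q"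
        unfolding cong_def by linarith
    qed (use q t bound in \<open>auto simp: b_def\<close>)
    also have "q ^ (h + 1 - n) \<le> exp (- c * real n) * exp (- c * real n)"
    proof -
      have "q ^ (h + 1 - n) = exp (real (h + 1 - n) * ln q)"
        using q by (simp add: exp_of_nat_mult)
      also have "real (h + 1 - n) * ln q \<le> \<delta> / 2 * real n * ln q"
      proof (rule mult_right_mono_neg)
        show "\<delta> / 2 * real n \<le> real (h + 1 - n)"
          using h(2) nh by (simp add: of_nat_diff algebra_simps)
      qed (use q in simp)
      also have "\<delta> / 2 * real n * ln q = - c * real n + - c * real n"
        unfolding c_def by (simp add: field_simps)
      finally show ?thesis by (simp only: exp_add exp_le_cancel_iff)
    qed
    also have "(1 + real n * t) * (real n * (exp (- c * real n) * exp (- c * real n)))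
        = ((1 + real n * t) * real n * exp (- c * real n)) * exp (- c * real n)"
      by simp
    also have "\<dots> \<le> 1 * exp (- c * real n)"
      using N[OF n(2)] unfolding t_def by (intro mult_right_mono) auto
    finally show ?thesis using t by (simp add: mult_left_mono)
  qed
  show ?thesis
  proof (rule exI[of _ c], intro conjI c allI impI)
    fix m :: "nat \<Rightarrow> nat" and \<mu> :: "nat \<Rightarrow> nat \<times> nat \<Rightarrow> int pmf"
    assume m: "\<forall>n\<ge>1. real (m n) \<ge> (2 + \<delta>) * real n"
      and bal: "\<forall>n\<ge>1. \<forall>i<n. \<forall>j<m n. eps_balanced eps (\<mu> n (i, j))"
      and bound: "\<forall>n\<ge>1. \<forall>i<n. \<forall>j<m n. \<forall>a\<in>set_pmf (\<mu> n (i, j)).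
          real_of_int \<bar>a\<bar> \<le> C * 2 powr (real n powr k)"
    show "\<exists>K N. \<forall>n\<ge>N. 1 - measure_pmf.prob (random_matrix n (m n) (\<mu> n))
        {A. int_mat_surj n (m n) A} \<le> K * exp (- c * real n)"
    proof (intro exI[where x = "1 :: real"] exI[where x = "max 1 N"] allI impI)
      fix n assume "max 1 N \<le> n"
      then have "n \<ge> 1" "n \<ge> N" by auto
      then show "1 - measure_pmf.prob (random_matrix n (m n) (\<mu> n))
        {A. int_mat_surj n (m n) A} \<le> 1 * exp (- c * real n)"
        using m bal bound by (intro main) auto
    qed
  qed
qed

end
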